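(* Let $n\ge 2$. The semigroup $\mathcal{SS}'_n$ is $\mathcal{R}$-trivial.
   Context: Let $[n]=\{1,2,\dots,n\}$ with its usual order. $\mathcal{P}_n$ is the semigroup of all partial transformations of $[n]$ (maps whose domain and image are subsets of $[n]$, including the empty map), composed from left to right: $x(\alpha\beta)=(x\alpha)\beta$. A partial map $\alpha$ is isotone if $x\le y$ implies $x\alpha\le y\alpha$ for all $x,y\in\mathrm{Dom}\,\alpha$, and order-decreasing if $x\alpha\le x$ for all $x\in\mathrm{Dom}\,\alpha$. $\mathcal{LS}_n$ is the monoid of all isotone order-decreasing $\alpha\in\mathcal{P}_n$, and $\mathcal{SS}'_n=\{\alpha\in\mathcal{LS}_n: 1\notin \mathrm{Dom}\,\alpha\}$, a subsemigroup of $\mathcal{LS}_n$. For a semigroup $S$, $S^1$ is $S$ with an identity adjoined if necessary; Green's relation $\mathcal{R}$ on $S$ is given by $a\,\mathcal{R}\,b$ iff $aS^1=bS^1$. $S$ is $\mathcal{R}$-trivial if $\mathcal{R}$ is the equality relation on $S$. *)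

theory Defs
  imports Main
begin

section \<open>Semigroups on a carrier set and Green's relation R\<close>

text \<open>A semigroup is given by a carrier \<open>S\<close> and a multiplication \<open>m\<close> that is only relevant on \<open>S\<close>.\<close>

definition is_semigroup :: "'a set \<Rightarrow> ('a \<Rightarrow> 'a \<Rightarrow> 'a) \<Rightarrow> bool" where
  "is_semigroup S m \<longleftrightarrow>
     (\<forall>a\<in>S. \<forall>b\<in>S. m a b \<in> S) \<and>
     (\<forall>a\<in>S. \<forall>b\<in>S. \<forall>c\<in>S. m (m a b) c = m a (m b c))"

definition has_identity :: "'a set \<Rightarrow> ('a \<Rightarrow> 'a \<Rightarrow> 'a) \<Rightarrow> bool" where
  "has_identity S m \<longleftrightarrow> (\<exists>e\<in>S. \<forall>a\<in>S. m e a = a \<and> m a e = a)"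

text \<open>\<open>S\<^sup>1\<close> lives in \<open>'a option\<close>: \<open>Some\<close> embeds \<open>S\<close>, and \<open>None\<close> is the new identity, which is
  adjoined only if \<open>S\<close> has no two-sided identity.\<close>

definition adjoin_one :: "'a set \<Rightarrow> ('a \<Rightarrow> 'a \<Rightarrow> 'a) \<Rightarrow> 'a option set" where
  "adjoin_one S m = (if has_identity S m then Some ` S else insert None (Some ` S))"

fun mult_one :: "('a \<Rightarrow> 'a \<Rightarrow> 'a) \<Rightarrow> 'a option \<Rightarrow> 'a option \<Rightarrow> 'a option" where
  "mult_one m None y = y"
| "mult_one m (Some a) None = Some a"
| "mult_one m (Some a) (Some b) = Some (m a b)"

text \<open>The principal right ideal \<open>a S\<^sup>1\<close>, as a subset of \<open>S\<^sup>1\<close>.\<close>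

definition right_ideal :: "'a set \<Rightarrow> ('a \<Rightarrow> 'a \<Rightarrow> 'a) \<Rightarrow> 'a \<Rightarrow> 'a option set" where
  "right_ideal S m a = {mult_one m (Some a) s | s. s \<in> adjoin_one S m}"

definition green_R :: "'a set \<Rightarrow> ('a \<Rightarrow> 'a \<Rightarrow> 'a) \<Rightarrow> 'a rel" where
  "green_R S m = {(a, b). a \<in> S \<and> b \<in> S \<and> right_ideal S m a = right_ideal S m b}"

definition R_trivial :: "'a set \<Rightarrow> ('a \<Rightarrow> 'a \<Rightarrow> 'a) \<Rightarrow> bool" where
  "R_trivial S m \<longleftrightarrow> green_R S m = Id_on S"


section \<open>Partial transformations of \<open>{1..n}\<close>\<close>

definition PT :: "nat \<Rightarrow> (nat \<rightharpoonup> nat) set" where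
  "PT n = {\<alpha>. dom \<alpha> \<subseteq> {1..n} \<and> ran \<alpha> \<subseteq> {1..n}}"

text \<open>Composition is from left to right, \<open>x (\<alpha>\<beta>) = (x\<alpha>) \<beta>\<close>, whereas \<open>(\<circ>\<^sub>m)\<close> applies its right
  argument first.\<close>

definition pcomp :: "(nat \<rightharpoonup> nat) \<Rightarrow> (nat \<rightharpoonup> nat) \<Rightarrow> (nat \<rightharpoonup> nat)" where
  "pcomp \<alpha> \<beta> = \<beta> \<circ>\<^sub>m \<alpha>"

definition isotone :: "(nat \<rightharpoonup> nat) \<Rightarrow> bool" where
  "isotone \<alpha> \<longleftrightarrow> (\<forall>x\<in>dom \<alpha>. \<forall>y\<in>dom \<alpha>. x \<le> y \<longrightarrow> the (\<alpha> x) \<le> the (\<alpha> y))"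

definition order_decreasing :: "(nat \<rightharpoonup> nat) \<Rightarrow> bool" where
  "order_decreasing \<alpha> \<longleftrightarrow> (\<forall>x\<in>dom \<alpha>. the (\<alpha> x) \<le> x)"

definition LS :: "nat \<Rightarrow> (nat \<rightharpoonup> nat) set" where
  "LS n = {\<alpha> \<in> PT n. isotone \<alpha> \<and> order_decreasing \<alpha>}"

definition SS' :: "nat \<Rightarrow> (nat \<rightharpoonup> nat) set" where
  "SS' n = {\<alpha> \<in> LS n. 1 \<notin> dom \<alpha>}"

lemma pcomp_eq_Some_iff: "pcomp \<alpha> \<beta> x = Some z \<longleftrightarrow> (\<exists>y. \<alpha> x = Some y \<and> \<beta> y = Some z)"
  by (simp add: pcomp_def map_comp_Some_iff)

lemma pcomp_assoc: "pcomp (pcomp \<alpha> \<beta>) \<gamma> = pcomp \<alpha> (pcomp \<beta> \<gamma>)"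
  by (rule ext) (simp add: pcomp_def map_comp_def split: option.split)

lemma pcomp_in_LS:
  assumes \<alpha>: "\<alpha> \<in> LS n" and \<beta>: "\<beta> \<in> LS n"
  shows "pcomp \<alpha> \<beta> \<in> LS n"
proof -
  have le: "y \<le> x" if "\<gamma> \<in> LS n" "\<gamma> x = Some y" for \<gamma> x y
    using that by (force simp: LS_def order_decreasing_def dom_def)
  have mono: "y \<le> y'" if "\<gamma> \<in> LS n" "\<gamma> x = Some y" "\<gamma> x' = Some y'" "x \<le> x'" for \<gamma> x x' y y'
    using that unfolding LS_def isotone_def by (metis (mono_tags, lifting) domI mem_Collect_eq option.sel)
  have "dom (pcomp \<alpha> \<beta>) \<subseteq> dom \<alpha>" "ran (pcomp \<alpha> \<beta>) \<subseteq> ran \<beta>"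
    by (auto simp: dom_def ran_def pcomp_eq_Some_iff)
  then have "pcomp \<alpha> \<beta> \<in> PT n"
    using \<alpha> \<beta> unfolding LS_def PT_def by blast
  moreover have "isotone (pcomp \<alpha> \<beta>)"
    unfolding isotone_def
  proof (intro ballI impI)
    fix x x' assume "x \<in> dom (pcomp \<alpha> \<beta>)" "x' \<in> dom (pcomp \<alpha> \<beta>)" and xx': "x \<le> x'"
    then obtain z z' where z: "pcomp \<alpha> \<beta> x = Some z" and z': "pcomp \<alpha> \<beta> x' = Some z'"
      by blast
    then obtain y y' where "\<alpha> x = Some y" "\<beta> y = Some z" "\<alpha> x' = Some y'" "\<beta> y' = Some z'"
      by (auto simp: pcomp_eq_Some_iff)
    then have "z \<le> z'"
      using mono[OF \<alpha> _ _ xx'] mono[OF \<beta>] by blast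
    then show "the (pcomp \<alpha> \<beta> x) \<le> the (pcomp \<alpha> \<beta> x')"
      by (simp add: z z')
  qed
  moreover have "order_decreasing (pcomp \<alpha> \<beta>)"
    unfolding order_decreasing_def
  proof
    fix x assume "x \<in> dom (pcomp \<alpha> \<beta>)"
    then obtain z where z: "pcomp \<alpha> \<beta> x = Some z"
      by blast
    then obtain y where "\<alpha> x = Some y" "\<beta> y = Some z"
      by (auto simp: pcomp_eq_Some_iff)
    then have "z \<le> x"
      using le[OF \<alpha>] le[OF \<beta>] order_trans by blast
    then show "the (pcomp \<alpha> \<beta> x) \<le> x"
      by (simp add: z)
  qed
  ultimately show ?thesis
    by (simp add: LS_def)
qed

lemma is_semigroup_LS: "is_semigroup (LS n) pcomp"
  by (simp add: is_semigroup_def pcomp_in_LS pcomp_assoc)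

lemma is_semigroup_SS': "is_semigroup (SS' n) pcomp"
proof -
  have "pcomp \<alpha> \<beta> \<in> SS' n" if "\<alpha> \<in> SS' n" "\<beta> \<in> SS' n" for \<alpha> \<beta>
    using that by (auto simp: SS'_def pcomp_in_LS pcomp_eq_Some_iff)
  then show ?thesis
    by (simp add: is_semigroup_def pcomp_assoc)
qed

end

(* Right multiplication by an order-decreasing map can only shrink the domain and lower the
   values. Hence two R-related maps lie below each other in the pointwise order on partial maps,
   which is antisymmetric. *)
theory Submission
  imports Defs
begin

text \<open>The multiplier that returns \<open>a\<close> depends on \<open>adjoin_one\<close>: an
  identity of \<open>S\<close> if there is one, otherwise the adjoined \<open>None\<close>.\<close>

lemma Some_in_right_ideal:
  assumes "a \<in> S"
  shows "Some a \<in> right_ideal S m a"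
proof (cases "has_identity S m")
  case True
  then obtain e where "e \<in> S" "m a e = a"
    using assms unfolding has_identity_def by blast
  then have "Some a = mult_one m (Some a) (Some e)" "Some e \<in> adjoin_one S m"
    using True by (simp_all add: adjoin_one_def)
  then show ?thesis
    unfolding right_ideal_def by blast
next
  case False
  then have "Some a = mult_one m (Some a) None" "None \<in> adjoin_one S m"
    by (simp_all add: adjoin_one_def)
  then show ?thesis
    unfolding right_ideal_def by blast
qed

lemma Some_in_right_idealD:
  assumes "Some b \<in> right_ideal S m a"
  shows "b = a \<or> (\<exists>s\<in>S. b = m a s)"
  using assms by (auto simp: right_ideal_def adjoin_one_def split: if_splits)

text \<open>Eliminates the adjoined identity: if two right ideals coincide, each contains the
  generator of the other, so each generator equals the other or is a right multiple of it by an
  element of \<open>S\<close>.\<close>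

lemma R_trivialI:
  assumes "\<And>a b. \<lbrakk>a \<in> S; b \<in> S; a = b \<or> (\<exists>s\<in>S. a = m b s); b = a \<or> (\<exists>s\<in>S. b = m a s)\<rbrakk> \<Longrightarrow> a = b"
  shows "R_trivial S m"
proof -
  have "a = b" if "a \<in> S" "b \<in> S" "right_ideal S m a = right_ideal S m b" for a b
    using assms[OF that(1,2)] Some_in_right_idealD Some_in_right_ideal that by metis
  then show ?thesis
    by (auto simp: R_trivial_def green_R_def)
qed

lemma pcomp_order_decreasing_le:
  assumes "order_decreasing \<sigma>" "pcomp \<beta> \<sigma> x = Some z"
  shows "\<exists>y\<ge>z. \<beta> x = Some y"
proof -
  obtain y where y: "\<beta> x = Some y" "\<sigma> y = Some z"
    using assms(2) by (auto simp: pcomp_eq_Some_iff)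
  then have "z \<le> y"
    using assms(1) by (force simp: order_decreasing_def dom_def)
  with y show ?thesis by blast
qed

text \<open>Undefined counts as the least value. The two hypotheses force equal domains, and
  antisymmetry on values does the rest.\<close>

lemma partial_map_antisym:
  fixes \<alpha> \<beta> :: "'a \<rightharpoonup> 'b::order"
  assumes "\<And>x z. \<alpha> x = Some z \<Longrightarrow> \<exists>y\<ge>z. \<beta> x = Some y"
    and "\<And>x z. \<beta> x = Some z \<Longrightarrow> \<exists>y\<ge>z. \<alpha> x = Some y"
  shows "\<alpha> = \<beta>"
proof
  fix x
  show "\<alpha> x = \<beta> x"
    using assms(1)[of x] assms(2)[of x]
    by (cases "\<alpha> x"; cases "\<beta> x") (auto intro: order.antisym)
qed

theorem theorem2p2:
  fixes n :: nat
  assumes "n \<ge> 2"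
  shows "R_trivial (SS' n) pcomp"
proof (rule R_trivialI)
  \<comment> \<open>Kept general in both maps so that it serves both directions of antisymmetry; if
    the maps are equal, y = z works, and otherwise \<sigma> lowers the value of \<beta>.\<close>
  have below: "\<exists>y\<ge>z. \<beta> x = Some y"
    if "\<alpha> = \<beta> \<or> (\<exists>\<sigma>\<in>SS' n. \<alpha> = pcomp \<beta> \<sigma>)" "\<alpha> x = Some z" for \<alpha> \<beta> x z
    using that pcomp_order_decreasing_le by (auto simp: SS'_def LS_def)
  fix \<alpha> \<beta>
  assume "\<alpha> = \<beta> \<or> (\<exists>\<sigma>\<in>SS' n. \<alpha> = pcomp \<beta> \<sigma>)" "\<beta> = \<alpha> \<or> (\<exists>\<sigma>\<in>SS' n. \<beta> = pcomp \<alpha> \<sigma>)"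
  then show "\<alpha> = \<beta>"
    using below by (intro partial_map_antisym) blast+
qed

end
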